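(* Let $d,\gamma,p\in\mathbb N$ with $p>\gamma$ and let $\mathbf x_0\in\mathbb R^d$. Consider a linear differential operator of order at most $\gamma$, $\mathcal L=\sum_{m=0}^\gamma\sum_{|\mathbf j|=m}c_{\mathbf j}\,\partial_{\mathbf x}^{\mathbf j}$, with variable coefficients $c_{\mathbf j}\in\mathcal C^{p-\gamma}(\mathbf x_0)$ for $\mathbf j\in\mathbb N_0^d$, $|\mathbf j|\le\gamma$, and the corresponding constant-coefficient operator $\mathcal L_*=\sum_{|\mathbf j|=\gamma}c_{\mathbf j}(\mathbf x_0)\,\partial_{\mathbf x}^{\mathbf j}$. Assume that $\mathcal L_*|_{\mathbb P_p}:\mathbb P_p\to\mathbb P_{p-\gamma}$ is surjective. Then the quasi-Trefftz operator $\mathcal D_p=T_{p-\gamma}\circ\mathcal L:\mathbb P_p\to\mathbb P_{p-\gamma}$ and its restriction $\mathcal D_p|_{\bigoplus_{\ell=\gamma}^p\widetilde{\mathbb P}_\ell}$ are both surjective onto $\mathbb P_{p-\gamma}$. Moreover, let $\mathcal R=\mathcal D_p-\mathcal L_*:\mathbb P_p\to\mathbb P_{p-\gamma}$, let $s=p-\gamma$, and let $\mathcal S_*:\mathbb P_{p-\gamma}\to\mathbb P_p$ be a linear right inverse of $\mathcal L_*|_{\mathbb P_p}$ such that $\mathcal S_*(\widetilde{\mathbb P}_n)\subset\widetilde{\mathbb P}_{n+\gamma}$ for all $n\in\{0,\dots,p-\gamma\}$. Then the operator $\mathcal S:\mathbb P_{p-\gamma}\to\mathbb P_p$ given by $\mathcal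 S=\mathcal S_*\circ\sum_{l=0}^{s}[-\mathcal R\circ\mathcal S_*]^l$ is a right inverse of $\mathcal D_p$.
   Context: $\mathbb N$ is the set of positive integers and $\mathbb N_0=\mathbb N\cup\{0\}$; $\mathbb K=\mathbb R$ or $\mathbb C$. $\mathcal C^n(\mathbf x_0)$ is the space of ($\mathbb K$-valued) functions with continuous derivatives up to order $n$ in a neighborhood of $\mathbf x_0$. $\mathbb P_p$ is the space of polynomials in $d$ variables of degree at most $p$ over $\mathbb K$. $\widetilde{\mathbb P}_l$ is the space of homogeneous polynomials of degree $l$ in the shifted variable $\mathbf X-\mathbf x_0$, i.e. the span of $(\mathbf X-\mathbf x_0)^{\mathbf i}$ with $|\mathbf i|=l$, so $\mathbb P_p=\bigoplus_{l=0}^p\widetilde{\mathbb P}_l$. For $\varphi\in\mathcal C^k(\mathbf x_0)$, $T_k[\varphi]=\sum_{l=0}^k\sum_{|\mathbf i|=l}\frac1{\mathbf i!}\partial^{\mathbf i}\varphi(\mathbf x_0)(\mathbf X-\mathbf x_0)^{\mathbf i}\in\mathbb P_k$ is its $k$th Taylor polynomial at $\mathbf x_0$. *)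

theory Defs
  imports "HOL-Analysis.Analysis" "HOL-Library.Function_Algebras"
begin

text \<open>
  The scalar field is a type \<open>'k :: real_normed_field\<close>.  By the Gelfand--Mazur theorem the
  instances of this class are, up to isometric isomorphism, exactly the real and the complex
  numbers.  The dimension is \<open>d = CARD('d)\<close>, and functions on \<open>real ^ 'd\<close> carry
  the pointwise operations of \<open>Function_Algebras\<close>.
\<close>

definition fscale :: "'k::field \<Rightarrow> ('a \<Rightarrow> 'k) \<Rightarrow> 'a \<Rightarrow> 'k"
  where "fscale a f = (\<lambda>x. a * f x)"

global_interpretation fun_vs: vector_space "fscale :: 'k::field \<Rightarrow> ('a \<Rightarrow> 'k) \<Rightarrow> 'a \<Rightarrow> 'k"
  by unfold_locales (auto simp: fscale_def fun_eq_iff algebra_simps)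

definition linear_map_on ::
  "('a \<Rightarrow> 'k::field) set \<Rightarrow> ('b \<Rightarrow> 'k) set \<Rightarrow> (('a \<Rightarrow> 'k) \<Rightarrow> ('b \<Rightarrow> 'k)) \<Rightarrow> bool"
  where "linear_map_on V W T \<longleftrightarrow>
    T ` V \<subseteq> W \<and>
    (\<forall>f\<in>V. \<forall>g\<in>V. T (f + g) = T f + T g) \<and>
    (\<forall>a. \<forall>f\<in>V. T (fscale a f) = fscale a (T f))"

text \<open>For \<open>T : V \<rightarrow> W\<close>, the map \<open>S : W \<rightarrow> V\<close> satisfies \<open>T \<circ> S = id\<close> on \<open>W\<close>.\<close>

definition right_inverse_on :: "'a set \<Rightarrow> 'b set \<Rightarrow> ('a \<Rightarrow> 'b) \<Rightarrow> ('b \<Rightarrow> 'a) \<Rightarrow> bool"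
  where "right_inverse_on V W T S \<longleftrightarrow> S ` W \<subseteq> V \<and> (\<forall>g\<in>W. T (S g) = g)"


subsection \<open>Multi-indices and polynomials\<close>

type_synonym 'd mindex = "'d \<Rightarrow> nat"

definition mdeg :: "'d::finite mindex \<Rightarrow> nat"
  where "mdeg i = (\<Sum>k\<in>UNIV. i k)"

definition mfact :: "'d::finite mindex \<Rightarrow> nat"
  where "mfact i = (\<Prod>k\<in>UNIV. fact (i k))"

lemma finite_mdeg_le: "finite {i :: 'd::finite mindex. mdeg i \<le> n}"
proof (rule finite_subset)
  show "{i :: 'd mindex. mdeg i \<le> n} \<subseteq> (\<Pi>\<^sub>E k\<in>UNIV. {..n})"
  proof
    fix i :: "'d mindex"
    assume "i \<in> {i. mdeg i \<le> n}"
    then have le: "sum i UNIV \<le> n"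
      by (simp add: mdeg_def)
    have "i k \<le> n" for k
      using member_le_sum[of k UNIV i] le by simp
    then show "i \<in> (\<Pi>\<^sub>E k\<in>UNIV. {..n})"
      by (intro PiE_I) simp_all
  qed
  show "finite (\<Pi>\<^sub>E k\<in>(UNIV :: 'd set). {..n})"
    by (rule finite_PiE) simp_all
qed

lemma finite_mdeg_eq: "finite {i :: 'd::finite mindex. mdeg i = n}"
  by (rule finite_subset[OF _ finite_mdeg_le[of n]]) auto

definition monom_at :: "real ^ 'd \<Rightarrow> 'd::finite mindex \<Rightarrow> real ^ 'd \<Rightarrow> 'k::real_normed_field"
  where "monom_at x0 i = (\<lambda>x. \<Prod>k\<in>UNIV. of_real (x $ k - x0 $ k) ^ i k)"

definition poly_space :: "nat \<Rightarrow> (real ^ 'd::finite \<Rightarrow> 'k::real_normed_field) set"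
  where "poly_space p = fun_vs.span {monom_at 0 i | i. mdeg i \<le> p}"

definition hom_space :: "real ^ 'd \<Rightarrow> nat \<Rightarrow> (real ^ 'd::finite \<Rightarrow> 'k::real_normed_field) set"
  where "hom_space x0 l = fun_vs.span {monom_at x0 i | i. mdeg i = l}"

definition hom_sum :: "real ^ 'd \<Rightarrow> nat \<Rightarrow> nat \<Rightarrow> (real ^ 'd::finite \<Rightarrow> 'k::real_normed_field) set"
  where "hom_sum x0 m n = {(\<Sum>l\<in>{m..n}. q l) | q. \<forall>l\<in>{m..n}. q l \<in> hom_space x0 l}"


subsection \<open>Partial derivatives and functions of class \<open>C\<^sup>n\<close> near a point\<close>

definition partial :: "'d \<Rightarrow> (real ^ 'd \<Rightarrow> 'k) \<Rightarrow> real ^ 'd::finite \<Rightarrow> 'k::real_normed_field"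
  where "partial k f x = vector_derivative (\<lambda>t. f (x + t *\<^sub>R axis k 1)) (at 0)"

text \<open>
  The coordinates are processed in one fixed but arbitrary order.  For functions whose derivatives
  up to order \<open>mdeg j\<close> are continuous the order is irrelevant by Schwarz's theorem.
\<close>

definition coords :: "'d::finite list"
  where "coords = (SOME ks. distinct ks \<and> set ks = UNIV)"

lemma distinct_coords: "distinct (coords :: 'd::finite list)"
  and set_coords: "set (coords :: 'd::finite list) = UNIV"
proof -
  have "\<exists>ks :: 'd list. distinct ks \<and> set ks = UNIV"
    using finite_distinct_list[of "UNIV :: 'd set"] by auto
  from someI_ex[OF this] show "distinct (coords :: 'd list)" "set (coords :: 'd list) = UNIV"
    by (simp_all add: coords_def)
qed

definition mpartial ::
  "'d mindex \<Rightarrow> (real ^ 'd \<Rightarrow> 'k) \<Rightarrow> real ^ 'd::finite \<Rightarrow> 'k::real_normed_field"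
  where "mpartial j f = foldr (\<lambda>k. partial k ^^ j k) coords f"

primrec Cn_on :: "nat \<Rightarrow> (real ^ 'd::finite) set \<Rightarrow> (real ^ 'd \<Rightarrow> 'k::real_normed_field) \<Rightarrow> bool"
  where
    "Cn_on 0 U f \<longleftrightarrow> continuous_on U f"
  | "Cn_on (Suc n) U f \<longleftrightarrow> continuous_on U f \<and>
       (\<forall>k. (\<forall>x\<in>U. (\<lambda>t. f (x + t *\<^sub>R axis k 1)) differentiable (at 0)) \<and> Cn_on n U (partial k f))"

definition Cn_at :: "nat \<Rightarrow> real ^ 'd::finite \<Rightarrow> (real ^ 'd \<Rightarrow> 'k::real_normed_field) set"
  where "Cn_at n x0 = {f. \<exists>U. open U \<and> x0 \<in> U \<and> Cn_on n U f}"

definition taylor ::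
  "nat \<Rightarrow> real ^ 'd \<Rightarrow> (real ^ 'd \<Rightarrow> 'k) \<Rightarrow> real ^ 'd::finite \<Rightarrow> 'k::real_normed_field"
  where "taylor k x0 f =
    (\<Sum>l\<in>{0..k}. \<Sum>i\<in>{i. mdeg i = l}. fscale (1 / of_nat (mfact i) * mpartial i f x0) (monom_at x0 i))"


subsection \<open>Differential operators\<close>

definition diff_op ::
  "nat \<Rightarrow> ('d mindex \<Rightarrow> real ^ 'd \<Rightarrow> 'k) \<Rightarrow> (real ^ 'd \<Rightarrow> 'k) \<Rightarrow> real ^ 'd::finite \<Rightarrow> 'k::real_normed_field"
  where "diff_op \<gamma> c f = (\<lambda>x. \<Sum>m\<in>{0..\<gamma>}. \<Sum>j\<in>{j. mdeg j = m}. c j x * mpartial j f x)"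

definition frozen_op ::
  "nat \<Rightarrow> ('d mindex \<Rightarrow> real ^ 'd \<Rightarrow> 'k) \<Rightarrow> real ^ 'd \<Rightarrow> (real ^ 'd \<Rightarrow> 'k) \<Rightarrow> real ^ 'd::finite \<Rightarrow> 'k::real_normed_field"
  where "frozen_op \<gamma> c x0 f = (\<lambda>x. \<Sum>j\<in>{j. mdeg j = \<gamma>}. c j x0 * mpartial j f x)"

definition quasi_trefftz_op ::
  "nat \<Rightarrow> nat \<Rightarrow> ('d mindex \<Rightarrow> real ^ 'd \<Rightarrow> 'k) \<Rightarrow> real ^ 'd \<Rightarrow> (real ^ 'd \<Rightarrow> 'k) \<Rightarrow> real ^ 'd::finite \<Rightarrow> 'k::real_normed_field"
  where "quasi_trefftz_op p \<gamma> c x0 = taylor (p - \<gamma>) x0 \<circ> diff_op \<gamma> c"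

end

theory Submission
  imports Defs
begin

text \<open>
  Write \<open>D\<close> for the quasi-Trefftz operator, \<open>L\<close> for the frozen operator, \<open>s = p - \<gamma>\<close>, and grade
  polynomials by their homogeneous degree at \<open>x0\<close>.  Freezing and truncating disturb only higher
  degrees.  Indeed \<open>L\<close> lowers every degree by exactly \<open>\<gamma>\<close>.  If \<open>q\<close> is homogeneous of degree \<open>n + \<gamma>\<close>
  and \<open>i\<close> has degree at most \<open>n\<close>, then in the Leibniz expansion of
  \<open>\<partial>\<^sup>i (c\<^sub>j \<partial>\<^sup>j q)(x0)\<close> every term that differentiates \<open>c\<^sub>j\<close>, and every term at all
  when \<open>j\<close> has degree below \<open>\<gamma>\<close>, contains a derivative of \<open>q\<close> of order below \<open>n + \<gamma>\<close>, which vanishes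
  at \<open>x0\<close>
  (\<open>iter_partial_mult_vanishing\<close>, \<open>mpartial_diff_op_leading\<close>).  Hence \<open>D q\<close> and \<open>L q\<close> have the same
  Taylor coefficients up to degree \<open>n\<close>, and the remainder \<open>D - L\<close> maps degrees at least \<open>n + \<gamma>\<close> to
  degrees at least \<open>n + 1\<close> (\<open>remainder_raises_degree\<close>).

  Surjectivity follows by removing the lowest degree of the target repeatedly: because \<open>L\<close> respects
  the grading, its surjectivity restricts to each degree (\<open>frozen_onto_degree\<close>); a preimage under \<open>L\<close>
  of the lowest component is a preimage under \<open>D\<close> up to an error of higher degree, and above
  degree \<open>s\<close> nothing is left (\<open>D_onto_from_degree\<close>).  Only arguments of degree at least \<open>\<gamma>\<close> occur,
  so the restricted operator is covered too.

  For the right inverse, put \<open>N = - (D - L) \<circ> S0\<close>.  On the polynomials of degree at most \<open>s\<close>,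
  \<open>D \<circ> S0 = id - N\<close> and \<open>N\<close> raises the lowest degree, so \<open>N\<close> composed with itself \<open>s + 1\<close>
  times is zero there and the finite Neumann series inverts \<open>id - N\<close> (\<open>neumann_right_inverse\<close>).
\<close>

section \<open>Partial derivatives along coordinate lines\<close>

definition partially_differentiable ::
  "'d \<Rightarrow> (real ^ 'd::finite \<Rightarrow> 'k::real_normed_field) \<Rightarrow> real ^ 'd \<Rightarrow> bool"
  where "partially_differentiable k f x \<longleftrightarrow>
    (\<lambda>t. f (x + t *\<^sub>R axis k 1)) differentiable (at 0)"

lemma partially_differentiable_iff_partial:
  "partially_differentiable k f x \<longleftrightarrow>
    ((\<lambda>t. f (x + t *\<^sub>R axis k 1)) has_vector_derivative partial k f x) (at 0)"
  by (simp add: partially_differentiable_def partial_def vector_derivative_works)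

lemma partial_eqI:
  assumes "((\<lambda>t. f (x + t *\<^sub>R axis k 1)) has_vector_derivative v) (at 0)"
  shows "partially_differentiable k f x" and "partial k f x = v"
  using assms unfolding partially_differentiable_def partial_def
  by (auto simp: vector_derivative_at intro: differentiableI_vector)

lemma partial_local:
  assumes "open U" "x \<in> U" "\<And>y. y \<in> U \<Longrightarrow> f y = g y" "partially_differentiable k f x"
  shows "partially_differentiable k g x" and "partial k g x = partial k f x"
proof -
  have "continuous_on UNIV (\<lambda>t. x + t *\<^sub>R axis k (1::real))"
    by (intro continuous_intros)
  then have V: "open ((\<lambda>t. x + t *\<^sub>R axis k (1::real)) -` U)"
    using \<open>open U\<close> by (rule open_vimage[rotated])
  have "((\<lambda>t. g (x + t *\<^sub>R axis k 1)) has_vector_derivative partial k f x) (at 0)"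
    using assms(4) unfolding partially_differentiable_iff_partial
    by (rule has_vector_derivative_transform_within_open[OF _ V]) (use assms in auto)
  from partial_eqI[OF this]
  show "partially_differentiable k g x" "partial k g x = partial k f x"
    by auto
qed

lemma partial_add:
  assumes "partially_differentiable k f x" "partially_differentiable k g x"
  shows "partially_differentiable k (\<lambda>y. f y + g y) x"
    and "partial k (\<lambda>y. f y + g y) x = partial k f x + partial k g x"
proof -
  have "((\<lambda>t. f (x + t *\<^sub>R axis k 1) + g (x + t *\<^sub>R axis k 1))
    has_vector_derivative partial k f x + partial k g x) (at 0)"
    using assms unfolding partially_differentiable_iff_partial by (rule has_vector_derivative_add)
  from partial_eqI[where f = "\<lambda>y. f y + g y", OF this]
  show "partially_differentiable k (\<lambda>y. f y + g y) x"
    "partial k (\<lambda>y. f y + g y) x = partial k f x + partial k g x" by auto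
qed

lemma partial_mult:
  assumes "partially_differentiable k f x" "partially_differentiable k g x"
  shows "partially_differentiable k (\<lambda>y. f y * g y) x"
    and "partial k (\<lambda>y. f y * g y) x = f x * partial k g x + partial k f x * g x"
proof -
  have "((\<lambda>t. f (x + t *\<^sub>R axis k 1) * g (x + t *\<^sub>R axis k 1))
    has_vector_derivative f x * partial k g x + partial k f x * g x) (at 0)"
    using has_vector_derivative_mult[OF assms[unfolded partially_differentiable_iff_partial]]
    by simp
  from partial_eqI[where f = "\<lambda>y. f y * g y", OF this]
  show "partially_differentiable k (\<lambda>y. f y * g y) x"
    "partial k (\<lambda>y. f y * g y) x = f x * partial k g x + partial k f x * g x" by auto
qed

lemma partial_const:
  "partially_differentiable k (\<lambda>y. a) x" "partial k (\<lambda>y. a) x = 0"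
proof -
  have "((\<lambda>t :: real. a) has_vector_derivative 0) (at 0)"
    by simp
  from partial_eqI[where f = "\<lambda>y. a", OF this]
  show "partially_differentiable k (\<lambda>y. a) x" "partial k (\<lambda>y. a) x = 0"
    by auto
qed

lemma Cn_on_Suc_iff:
  "Cn_on (Suc n) U f \<longleftrightarrow> continuous_on U f \<and>
    (\<forall>k. (\<forall>x\<in>U. partially_differentiable k f x) \<and> Cn_on n U (partial k f))"
  by (simp add: partially_differentiable_def)

declare Cn_on.simps(2) [simp del]

lemma Cn_on_continuous: "Cn_on n U f \<Longrightarrow> continuous_on U f"
  by (cases n) (auto simp: Cn_on_Suc_iff)

lemma Cn_on_SucD:
  assumes "Cn_on (Suc n) U f"
  shows "x \<in> U \<Longrightarrow> partially_differentiable k f x" and "Cn_on n U (partial k f)"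
  using assms by (auto simp: Cn_on_Suc_iff)

lemma Cn_on_Suc_imp: "Cn_on (Suc n) U f \<Longrightarrow> Cn_on n U f"
proof (induction n arbitrary: f)
  case 0
  then show ?case by (simp add: Cn_on_continuous)
next
  case (Suc n)
  then show ?case by (auto simp: Cn_on_Suc_iff[of n] Cn_on_Suc_iff[of "Suc n"])
qed

lemma Cn_on_le:
  assumes "Cn_on n U f" "m \<le> n"
  shows "Cn_on m U f"
  using assms(2,1) by (induction rule: dec_induct) (blast dest: Cn_on_Suc_imp)+

lemma Cn_on_subset: "Cn_on n U f \<Longrightarrow> V \<subseteq> U \<Longrightarrow> Cn_on n V f"
  by (induction n arbitrary: f) (auto simp: Cn_on_Suc_iff intro: continuous_on_subset)

lemma Cn_on_cong:
  assumes "open U" "Cn_on n U f" "\<And>y. y \<in> U \<Longrightarrow> f y = g y"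
  shows "Cn_on n U g"
  using assms(2,3)
proof (induction n arbitrary: f g)
  case 0
  then show ?case using continuous_on_cong by auto
next
  case (Suc n)
  have pd: "partially_differentiable k f x" if "x \<in> U" for k x
    using Suc.prems(1) that by (rule Cn_on_SucD)
  have "continuous_on U g"
    using Cn_on_continuous[OF Suc.prems(1)] Suc.prems(2) continuous_on_cong by fastforce
  moreover have "partially_differentiable k g x" if "x \<in> U" for k x
    using partial_local(1)[OF assms(1) that Suc.prems(2) pd[OF that]] .
  moreover have "Cn_on n U (partial k g)" for k
    using Cn_on_SucD(2)[OF Suc.prems(1)]
    by (rule Suc.IH) (use partial_local(2)[OF assms(1) _ Suc.prems(2) pd] in auto)
  ultimately show ?case by (simp add: Cn_on_Suc_iff)
qed

lemma partial_const_fun: "partial k (\<lambda>y :: real ^ 'd::finite. a) = (\<lambda>y. 0)"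
  by (simp add: fun_eq_iff partial_const)

lemma Cn_on_const: "Cn_on n U (\<lambda>x. a)"
  by (induction n arbitrary: a) (simp_all add: Cn_on_Suc_iff partial_const partial_const_fun)

lemma Cn_on_add:
  assumes "open U" "Cn_on n U f" "Cn_on n U g"
  shows "Cn_on n U (\<lambda>x. f x + g x)"
  using assms(2,3)
proof (induction n arbitrary: f g)
  case 0
  then show ?case by (auto intro: continuous_intros)
next
  case (Suc n)
  note pd = Cn_on_SucD(1)[OF Suc.prems(1)] Cn_on_SucD(1)[OF Suc.prems(2)]
  have "Cn_on n U (\<lambda>x. partial k f x + partial k g x)" for k
    using Suc.prems[THEN Cn_on_SucD(2)] by (rule Suc.IH)
  then have "Cn_on n U (partial k (\<lambda>x. f x + g x))" for k
    by (rule Cn_on_cong[OF assms(1)]) (simp add: partial_add pd)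
  then show ?case
    using Suc.prems by (simp add: Cn_on_Suc_iff continuous_on_add partial_add)
qed

lemma Cn_on_mult:
  assumes "open U" "Cn_on n U f" "Cn_on n U g"
  shows "Cn_on n U (\<lambda>x. f x * g x)"
  using assms(2,3)
proof (induction n arbitrary: f g)
  case 0
  then show ?case by (auto intro: continuous_intros)
next
  case (Suc n)
  note pd = Cn_on_SucD(1)[OF Suc.prems(1)] Cn_on_SucD(1)[OF Suc.prems(2)]
  have "Cn_on n U (\<lambda>x. f x * partial k g x + partial k f x * g x)" for k
    using Suc.prems[THEN Cn_on_Suc_imp] Suc.prems[THEN Cn_on_SucD(2)]
    by (intro Cn_on_add[OF assms(1)] Suc.IH)
  then have "Cn_on n U (partial k (\<lambda>x. f x * g x))" for k
    by (rule Cn_on_cong[OF assms(1)]) (simp add: partial_mult pd)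
  then show ?case
    using Suc.prems by (simp add: Cn_on_Suc_iff continuous_on_mult partial_mult)
qed

lemma Cn_on_sum:
  assumes "open U" "\<And>j. j \<in> J \<Longrightarrow> Cn_on n U (f j)"
  shows "Cn_on n U (\<lambda>x. \<Sum>j\<in>J. f j x)"
  using assms(2)
  by (induction J rule: infinite_finite_induct) (auto intro: Cn_on_const Cn_on_add[OF assms(1)])


section \<open>Iterated partial derivatives\<close>

text \<open>Words of coordinates, rather than multi-indices, index iterated derivatives: the product rule
  below inducts on the word, which avoids any appeal to the symmetry of mixed derivatives.\<close>

definition iter_partial ::
  "'d list \<Rightarrow> (real ^ 'd::finite \<Rightarrow> 'k) \<Rightarrow> real ^ 'd \<Rightarrow> 'k::real_normed_field"
  where "iter_partial = fold partial"

lemma iter_partial_simps [simp]: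
  "iter_partial [] f = f"
  "iter_partial (k # ks) f = iter_partial ks (partial k f)"
  by (simp_all add: iter_partial_def)

lemma iter_partial_append: "iter_partial (ks @ ls) f = iter_partial ls (iter_partial ks f)"
  by (simp add: iter_partial_def)

lemma iter_partial_replicate: "iter_partial (replicate n k) f = (partial k ^^ n) f"
  by (induction n arbitrary: f) (auto simp: funpow_swap1)

lemma mpartial_eq_iter_partial:
  fixes j :: "'d::finite mindex"
  obtains ks :: "'d list" where "length ks = mdeg j"
    "\<And>f :: real ^ 'd \<Rightarrow> 'k::real_normed_field. mpartial j f = iter_partial ks f"
proof -
  have "\<exists>ks. length ks = (\<Sum>k\<in>set cs. j k) \<and>
      (\<forall>f :: real ^ 'd \<Rightarrow> 'k. foldr (\<lambda>k. partial k ^^ j k) cs f = iter_partial ks f)"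
    if "distinct cs" for cs
    using that
  proof (induction cs)
    case Nil
    then show ?case by simp
  next
    case (Cons c cs)
    then obtain ks where "length ks = (\<Sum>k\<in>set cs. j k)"
      "\<forall>f :: real ^ 'd \<Rightarrow> 'k. foldr (\<lambda>k. partial k ^^ j k) cs f = iter_partial ks f"
      by auto
    with Cons.prems show ?case
      by (intro exI[of _ "ks @ replicate (j c) c"])
        (simp add: iter_partial_append iter_partial_replicate)
  qed
  from this[OF distinct_coords] that show thesis
    by (auto simp: set_coords mdeg_def mpartial_def)
qed

lemma iter_partial_cong:
  assumes "open U" "x \<in> U" "Cn_on (length ks) U f" "\<And>y. y \<in> U \<Longrightarrow> f y = g y"
  shows "iter_partial ks f x = iter_partial ks g x"
  using assms(3,4)
proof (induction ks arbitrary: f g)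
  case Nil
  then show ?case using assms(2) by simp
next
  case (Cons k ks)
  have C: "Cn_on (Suc (length ks)) U f" using Cons.prems(1) by simp
  show ?case
    unfolding iter_partial_simps
    using Cn_on_SucD(2)[OF C]
    by (rule Cons.IH)
      (use partial_local(2)[OF assms(1) _ Cons.prems(2) Cn_on_SucD(1)[OF C]] in auto)
qed

lemma iter_partial_add:
  assumes "open U" "x \<in> U" "Cn_on (length ks) U f" "Cn_on (length ks) U g"
  shows "iter_partial ks (\<lambda>y. f y + g y) x = iter_partial ks f x + iter_partial ks g x"
  using assms(3,4)
proof (induction ks arbitrary: f g)
  case Nil
  then show ?case by simp
next
  case (Cons k ks)
  have C: "Cn_on (Suc (length ks)) U f" "Cn_on (Suc (length ks)) U g"
    using Cons.prems by simp_all
  note D = C[THEN Cn_on_SucD(2)]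
  have "iter_partial ks (partial k (\<lambda>y. f y + g y)) x
      = iter_partial ks (\<lambda>y. partial k f y + partial k g y) x"
    by (rule iter_partial_cong[OF assms(1,2), symmetric])
      (use Cn_on_add[OF assms(1) D] C[THEN Cn_on_SucD(1)] in \<open>auto simp: partial_add\<close>)
  with Cons.IH[OF D] show ?case by simp
qed

lemma iter_partial_const [simp]: "iter_partial ks (\<lambda>x. 0) x = 0"
  by (induction ks) (simp_all add: partial_const_fun)

lemma iter_partial_sum:
  assumes "open U" "x \<in> U" "\<And>j. j \<in> J \<Longrightarrow> Cn_on (length ks) U (f j)"
  shows "iter_partial ks (\<lambda>y. \<Sum>j\<in>J. f j y) x = (\<Sum>j\<in>J. iter_partial ks (f j) x)"
  using assms(3)
proof (induction J rule: infinite_finite_induct)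
  case (insert j J)
  then show ?case
    using iter_partial_add[OF assms(1,2), of ks "f j" "\<lambda>y. \<Sum>j\<in>J. f j y"]
      Cn_on_sum[OF assms(1), of J "length ks" f] by simp
qed simp_all

text \<open>All terms of the Leibniz expansion in which the factor \<open>c\<close> is differentiated contain a
  derivative of \<open>h\<close> of lower order at \<open>x\<close>, and therefore vanish.\<close>

lemma iter_partial_mult_vanishing:
  assumes "open U" "x \<in> U" "Cn_on (length ks) U c" "Cn_on (length ks) U h"
    and "\<And>ls. length ls < length ks \<Longrightarrow> iter_partial ls h x = 0"
  shows "iter_partial ks (\<lambda>y. c y * h y) x = c x * iter_partial ks h x"
  using assms(3-5)
proof (induction ks arbitrary: c h)
  case Nil
  then show ?case by simp
next
  case (Cons k ks)
  have C: "Cn_on (Suc (length ks)) U c" "Cn_on (Suc (length ks)) U h"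
    using Cons.prems by simp_all
  note D = C[THEN Cn_on_SucD(2)] and E = C[THEN Cn_on_Suc_imp]
  note M = Cn_on_mult[OF assms(1)]
  have "iter_partial ks (partial k (\<lambda>y. c y * h y)) x
      = iter_partial ks (\<lambda>y. c y * partial k h y + partial k c y * h y) x"
    by (rule iter_partial_cong[OF assms(1,2), symmetric])
      (use Cn_on_add[OF assms(1) M[OF E(1) D(2)] M[OF D(1) E(2)]] C[THEN Cn_on_SucD(1)]
        in \<open>auto simp: partial_mult\<close>)
  also have "\<dots> = iter_partial ks (\<lambda>y. c y * partial k h y) x
      + iter_partial ks (\<lambda>y. partial k c y * h y) x"
    by (rule iter_partial_add[OF assms(1,2) M[OF E(1) D(2)] M[OF D(1) E(2)]])
  also have "iter_partial ks (\<lambda>y. partial k c y * h y) x = partial k c x * iter_partial ks h x"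
    by (rule Cons.IH[OF D(1) E(2)]) (use Cons.prems(3) in simp)
  also have "iter_partial ks h x = 0"
    using Cons.prems(3)[of ks] by simp
  also have "iter_partial ks (\<lambda>y. c y * partial k h y) x = c x * iter_partial ks (partial k h) x"
    by (rule Cons.IH[OF E(1) D(2)]) (use Cons.prems(3)[of "k # _"] in simp)
  finally show ?case by simp
qed

lemma mpartial_add:
  fixes f g :: "real ^ 'd::finite \<Rightarrow> 'k::real_normed_field"
  assumes "open U" "x \<in> U" "Cn_on (mdeg i) U f" "Cn_on (mdeg i) U g"
  shows "mpartial i (\<lambda>y. f y + g y) x = mpartial i f x + mpartial i g x"
proof -
  obtain ks where "length ks = mdeg i" and "\<And>f :: real ^ 'd \<Rightarrow> 'k. mpartial i f = iter_partial ks f"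
    by (rule mpartial_eq_iter_partial[of i]) blast
  with iter_partial_add[OF assms(1,2), of ks f g] assms(3,4) show ?thesis
    by simp
qed

lemma mpartial_mult_vanishing:
  fixes c h :: "real ^ 'd::finite \<Rightarrow> 'k::real_normed_field"
  assumes "open U" "x \<in> U" "Cn_on (mdeg i) U c" "Cn_on (mdeg i) U h"
    and "\<And>ls. length ls < mdeg i \<Longrightarrow> iter_partial ls h x = 0"
  shows "mpartial i (\<lambda>y. c y * h y) x = c x * mpartial i h x"
proof -
  obtain ks where "length ks = mdeg i" and "\<And>f :: real ^ 'd \<Rightarrow> 'k. mpartial i f = iter_partial ks f"
    by (rule mpartial_eq_iter_partial[of i]) blast
  with iter_partial_mult_vanishing[OF assms(1,2), of ks c h] assms(3-5) show ?thesis
    by simp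
qed

lemma mpartial_sum:
  fixes f :: "'j \<Rightarrow> real ^ 'd::finite \<Rightarrow> 'k::real_normed_field"
  assumes "open U" "x \<in> U" "\<And>j. j \<in> J \<Longrightarrow> Cn_on (mdeg i) U (f j)"
  shows "mpartial i (\<lambda>y. \<Sum>j\<in>J. f j y) x = (\<Sum>j\<in>J. mpartial i (f j) x)"
proof -
  obtain ks where ks: "length ks = mdeg i" and "\<And>f :: real ^ 'd \<Rightarrow> 'k. mpartial i f = iter_partial ks f"
    by (rule mpartial_eq_iter_partial[of i]) blast
  with iter_partial_sum[OF assms(1,2), of J ks f] assms(3) show ?thesis
    by simp
qed


section \<open>Polynomials graded by the degrees at a point\<close>

text \<open>Describing a space by the set of degrees that may occur makes one statement cover the
  homogeneous, truncated and full spaces, and makes the lowering of degrees a preimage of sets in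
  which degrees that would become negative simply disappear.\<close>

definition poly_degs ::
  "real ^ 'd \<Rightarrow> nat set \<Rightarrow> (real ^ 'd::finite \<Rightarrow> 'k::real_normed_field) set"
  where "poly_degs x0 A = fun_vs.span {monom_at x0 i | i. mdeg i \<in> A}"

lemma subspace_poly_degs: "fun_vs.subspace (poly_degs x0 A)"
  by (simp add: poly_degs_def fun_vs.subspace_span)

lemma poly_degs_0: "0 \<in> poly_degs x0 A"
  by (rule fun_vs.subspace_0[OF subspace_poly_degs])

lemma poly_degs_add: "f \<in> poly_degs x0 A \<Longrightarrow> g \<in> poly_degs x0 A \<Longrightarrow> f + g \<in> poly_degs x0 A"
  by (rule fun_vs.subspace_add[OF subspace_poly_degs])

lemma poly_degs_diff: "f \<in> poly_degs x0 A \<Longrightarrow> g \<in> poly_degs x0 A \<Longrightarrow> f - g \<in> poly_degs x0 A"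
  by (rule fun_vs.subspace_diff[OF subspace_poly_degs])

lemma poly_degs_neg: "f \<in> poly_degs x0 A \<Longrightarrow> - f \<in> poly_degs x0 A"
  by (rule fun_vs.subspace_neg[OF subspace_poly_degs])

lemma poly_degs_scale: "f \<in> poly_degs x0 A \<Longrightarrow> fscale a f \<in> poly_degs x0 A"
  by (rule fun_vs.subspace_scale[OF subspace_poly_degs])

lemma poly_degs_sum:
  "(\<And>l. l \<in> L \<Longrightarrow> q l \<in> poly_degs x0 A) \<Longrightarrow> (\<Sum>l\<in>L. q l) \<in> poly_degs x0 A"
  by (rule fun_vs.subspace_sum[OF subspace_poly_degs])

lemma monom_in_poly_degs: "mdeg i \<in> A \<Longrightarrow> monom_at x0 i \<in> poly_degs x0 A"
  by (auto simp: poly_degs_def intro: fun_vs.span_base)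

lemma poly_degs_mono: "A \<subseteq> B \<Longrightarrow> poly_degs x0 A \<subseteq> poly_degs x0 B"
  unfolding poly_degs_def by (rule fun_vs.span_mono) auto

lemma poly_degs_empty: "poly_degs x0 {} = {0}"
  by (simp add: poly_degs_def)

lemma poly_degs_induct [consumes 1, case_names zero add scale_monom]:
  assumes q: "q \<in> poly_degs x0 A"
    and zero: "P 0"
    and add: "\<And>f g. f \<in> poly_degs x0 A \<Longrightarrow> g \<in> poly_degs x0 A \<Longrightarrow> P f \<Longrightarrow> P g \<Longrightarrow> P (f + g)"
    and scale_monom: "\<And>a i. mdeg i \<in> A \<Longrightarrow> P (fscale a (monom_at x0 i))"
  shows "P q"
proof -
  have "P q \<and> q \<in> poly_degs x0 A"
    using q[unfolded poly_degs_def]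
  proof (induction rule: fun_vs.span_induct_alt)
    case base
    show ?case by (intro conjI zero poly_degs_0)
  next
    case (step a m f)
    then obtain i where i: "mdeg i \<in> A" "m = monom_at x0 i" by auto
    then have "fscale a m \<in> poly_degs x0 A"
      by (simp add: poly_degs_scale monom_in_poly_degs)
    with step scale_monom[OF i(1), of a] i(2)
    show "P (fscale a m + f) \<and> fscale a m + f \<in> poly_degs x0 A"
      by (simp add: add poly_degs_add)
  qed
  then show ?thesis by simp
qed

lemma poly_degs_Un:
  fixes q :: "real ^ 'd::finite \<Rightarrow> 'k::real_normed_field"
  assumes "q \<in> poly_degs x0 (A \<union> B)"
  obtains q1 q2 where "q1 \<in> poly_degs x0 A" "q2 \<in> poly_degs x0 B" "q = q1 + q2"
proof -
  have "{monom_at x0 i :: real ^ 'd \<Rightarrow> 'k | i. mdeg i \<in> A \<union> B}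
      = {monom_at x0 i | i. mdeg i \<in> A} \<union> {monom_at x0 i | i. mdeg i \<in> B}"
    by auto
  with assms have "q \<in> {f + g | f g. f \<in> poly_degs x0 A \<and> g \<in> poly_degs x0 B}"
    unfolding poly_degs_def by (simp only: fun_vs.span_Un)
  with that show thesis by blast
qed

lemma hom_space_eq_poly_degs: "hom_space x0 l = poly_degs x0 {l}"
  by (simp add: hom_space_def poly_degs_def)

lemma hom_sum_eq_poly_degs: "hom_sum x0 m n = poly_degs x0 {m..n}"
proof
  show "hom_sum x0 m n \<subseteq> poly_degs x0 {m..n}"
  proof
    fix f assume "f \<in> hom_sum x0 m n"
    then obtain q where "f = (\<Sum>l\<in>{m..n}. q l)" "\<And>l. l \<in> {m..n} \<Longrightarrow> q l \<in> poly_degs x0 {l}"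
      by (auto simp: hom_sum_def hom_space_eq_poly_degs)
    moreover have "poly_degs x0 {l} \<subseteq> poly_degs x0 {m..n}" if "l \<in> {m..n}" for l
      using that by (intro poly_degs_mono) simp
    ultimately show "f \<in> poly_degs x0 {m..n}"
      by (metis poly_degs_sum subsetD)
  qed
  show "poly_degs x0 {m..n} \<subseteq> hom_sum x0 m n"
  proof
    fix f assume "f \<in> poly_degs x0 {m..n}"
    then show "f \<in> hom_sum x0 m n"
    proof (induction rule: poly_degs_induct)
      case zero
      show "0 \<in> hom_sum x0 m n" unfolding hom_sum_def hom_space_eq_poly_degs
        by (rule CollectI, rule exI[of _ "0"]) (auto simp: poly_degs_0 fun_eq_iff)
    next
      case (add f g)
      then obtain q r where "f = (\<Sum>l\<in>{m..n}. q l)" "g = (\<Sum>l\<in>{m..n}. r l)"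
        "\<forall>l\<in>{m..n}. q l \<in> poly_degs x0 {l}" "\<forall>l\<in>{m..n}. r l \<in> poly_degs x0 {l}"
        by (auto simp: hom_sum_def hom_space_eq_poly_degs)
      then show "f + g \<in> hom_sum x0 m n" unfolding hom_sum_def hom_space_eq_poly_degs
        by (intro CollectI exI[of _ "\<lambda>l. q l + r l"]) (simp add: poly_degs_add sum.distrib)
    next
      case (scale_monom a i)
      then show ?case unfolding hom_sum_def hom_space_eq_poly_degs
        by (intro CollectI exI[of _ "\<lambda>l. if l = mdeg i then fscale a (monom_at x0 i) else 0"])
          (simp add: poly_degs_0 poly_degs_scale monom_in_poly_degs)
    qed
  qed
qed

lemma mdeg_decr: "i k > 0 \<Longrightarrow> mdeg i = Suc (mdeg (i(k := i k - 1)))"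
  unfolding mdeg_def by (subst (1 2) sum.remove[of UNIV k]) auto

lemma mdeg_incr: "mdeg (i(k := Suc (i k))) = Suc (mdeg i)"
  unfolding mdeg_def by (subst (1 2) sum.remove[of UNIV k]) auto

lemma monom_at_incr:
  "monom_at x0 (i(k := Suc (i k))) x = of_real (x $ k - x0 $ k) * monom_at x0 i x"
  unfolding monom_at_def by (subst (1 2) prod.remove[of UNIV k]) (auto simp: mult_ac)

lemma monom_at_base: "monom_at x0 i x0 = (if mdeg i = 0 then 1 else 0)"
  by (auto simp: monom_at_def mdeg_def power_0_left intro!: prod_zero prod.neutral)

text \<open>Multiplication by a linear factor centred elsewhere: it differs from the factor centred at
  \<open>x0\<close> by a constant, which leaves the degree alone.\<close>

lemma poly_degs_times_shift:
  fixes q :: "real ^ 'd::finite \<Rightarrow> 'k::real_normed_field"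
  assumes "q \<in> poly_degs x0 {..n}"
  shows "(\<lambda>x. of_real (x $ k - y $ k) * q x) \<in> poly_degs x0 {..Suc n}"
  using assms
proof (induction rule: poly_degs_induct)
  case zero
  have eq: "(\<lambda>x. of_real (x $ k - y $ k) * (0 :: real ^ 'd \<Rightarrow> 'k) x) = 0"
    by (simp add: fun_eq_iff)
  show "(\<lambda>x. of_real (x $ k - y $ k) * (0 :: real ^ 'd \<Rightarrow> 'k) x) \<in> poly_degs x0 {..Suc n}"
    unfolding eq by (rule poly_degs_0)
next
  case (add f g)
  have eq: "(\<lambda>x. of_real (x $ k - y $ k) * (f + g) x)
      = (\<lambda>x. of_real (x $ k - y $ k) * f x) + (\<lambda>x. of_real (x $ k - y $ k) * g x)"
    by (simp add: fun_eq_iff distrib_left)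
  show "(\<lambda>x. of_real (x $ k - y $ k) * (f + g) x) \<in> poly_degs x0 {..Suc n}"
    unfolding eq using add(3,4) by (rule poly_degs_add)
next
  case (scale_monom a i)
  have eq: "(\<lambda>x. of_real (x $ k - y $ k) * fscale a (monom_at x0 i) x)
      = fscale a (monom_at x0 (i(k := Suc (i k)))) + fscale (a * of_real (x0 $ k - y $ k)) (monom_at x0 i)"
    by (simp add: fun_eq_iff fscale_def monom_at_incr algebra_simps)
  show "(\<lambda>x. of_real (x $ k - y $ k) * fscale a (monom_at x0 i) x) \<in> poly_degs x0 {..Suc n}"
    unfolding eq using scale_monom
    by (intro poly_degs_add poly_degs_scale monom_in_poly_degs) (auto simp: mdeg_incr)
qed

lemma monom_at_recentre:
  fixes x0 y :: "real ^ 'd::finite"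
  shows "(monom_at y i :: real ^ 'd \<Rightarrow> 'k::real_normed_field) \<in> poly_degs x0 {..mdeg i}"
proof (induction "mdeg i" arbitrary: i)
  case 0
  then have "i = (\<lambda>k. 0)" by (auto simp: mdeg_def)
  then have "(monom_at y i :: real ^ 'd \<Rightarrow> 'k) = monom_at x0 i" by (simp add: monom_at_def)
  then show ?case by (simp add: monom_in_poly_degs)
next
  case (Suc n)
  then obtain k where k: "i k > 0"
    by (metis mdeg_def sum.neutral gr0I old.nat.distinct(2))
  define j where "j = i(k := i k - 1)"
  have "n = mdeg j" using Suc.hyps(2) mdeg_decr[of i k] k by (simp add: j_def)
  moreover have "i = j(k := Suc (j k))" using k by (auto simp: j_def)
  then have "(monom_at y i :: real ^ 'd \<Rightarrow> 'k) = (\<lambda>x. of_real (x $ k - y $ k) * monom_at y j x)"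
    using monom_at_incr[of y j k] by (metis (mono_tags) ext)
  ultimately show ?case
    using poly_degs_times_shift[OF Suc.hyps(1)[of j]] Suc.hyps(2) by simp
qed

lemma poly_degs_recentre:
  fixes x0 y :: "real ^ 'd::finite"
  shows "(poly_degs y {..n} :: (real ^ 'd \<Rightarrow> 'k::real_normed_field) set) \<subseteq> poly_degs x0 {..n}"
  unfolding poly_degs_def[of y]
proof (rule fun_vs.span_minimal[OF _ subspace_poly_degs])
  have "(monom_at y i :: real ^ 'd \<Rightarrow> 'k) \<in> poly_degs x0 {..n}" if "mdeg i \<le> n" for i
    using poly_degs_mono[of "{..mdeg i}" "{..n}" x0] monom_at_recentre[of y i x0] that
    by auto
  then show "{monom_at y i :: real ^ 'd \<Rightarrow> 'k | i. mdeg i \<in> {..n}} \<subseteq> poly_degs x0 {..n}"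
    by auto
qed

lemma poly_space_eq_poly_degs: "poly_space n = poly_degs x0 {..n}"
proof -
  have "poly_space n = poly_degs 0 {..n}"
    by (simp add: poly_space_def poly_degs_def)
  then show ?thesis using poly_degs_recentre by blast
qed


section \<open>Derivatives of polynomials\<close>

lemma partial_monom_at:
  fixes x0 x :: "real ^ 'd::finite"
  shows "partially_differentiable k (monom_at x0 i :: real ^ 'd \<Rightarrow> 'k::real_normed_field) x"
    and "partial k (monom_at x0 i) x = (of_nat (i k) * monom_at x0 (i(k := i k - 1)) x :: 'k)"
proof -
  define C where "C = (\<Prod>m\<in>UNIV - {k}. of_real (x $ m - x0 $ m) ^ i m :: 'k)"
  have split: "(monom_at x0 i (x + t *\<^sub>R axis k 1) :: 'k) = C * of_real ((x $ k - x0 $ k + t) ^ i k)" for t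
    unfolding monom_at_def C_def
    by (subst prod.remove[of UNIV k]) (auto simp: axis_def mult.commute algebra_simps intro!: prod.cong)
  have split': "(monom_at x0 (i(k := i k - 1)) x :: 'k) = C * of_real ((x $ k - x0 $ k) ^ (i k - 1))"
    unfolding monom_at_def C_def
    by (subst prod.remove[of UNIV k]) (auto simp: mult.commute intro!: prod.cong)
  have "((\<lambda>t. (x $ k - x0 $ k + t) ^ i k) has_real_derivative
      of_nat (i k) * (x $ k - x0 $ k) ^ (i k - 1)) (at 0)"
    by (auto intro!: derivative_eq_intros)
  then have "((\<lambda>t. C * of_real ((x $ k - x0 $ k + t) ^ i k)) has_vector_derivative
      C * of_real (of_nat (i k) * (x $ k - x0 $ k) ^ (i k - 1))) (at 0)"
    by (intro has_vector_derivative_mult_right has_vector_derivative_of_real)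
      (simp add: has_real_derivative_iff_has_vector_derivative)
  then have "((\<lambda>t. monom_at x0 i (x + t *\<^sub>R axis k 1) :: 'k) has_vector_derivative
      (of_nat (i k) * monom_at x0 (i(k := i k - 1)) x :: 'k)) (at 0)"
    unfolding split split' by (simp add: mult_ac)
  from partial_eqI[OF this]
  show "partially_differentiable k (monom_at x0 i :: real ^ 'd \<Rightarrow> 'k) x"
    "partial k (monom_at x0 i) x = (of_nat (i k) * monom_at x0 (i(k := i k - 1)) x :: 'k)" by auto
qed

lemma partial_scale_monom_at:
  fixes a :: "'k::real_normed_field" and x0 x :: "real ^ 'd::finite"
  shows "partially_differentiable k (fscale a (monom_at x0 i)) x"
    and "partial k (fscale a (monom_at x0 i)) = fscale (a * of_nat (i k)) (monom_at x0 (i(k := i k - 1)))"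
proof -
  note m = partial_mult[OF partial_const(1)[of k a] partial_monom_at(1)[of k x0 i]]
  show "partially_differentiable k (fscale a (monom_at x0 i)) x"
    using m(1) by (simp add: fscale_def)
  show "partial k (fscale a (monom_at x0 i)) = fscale (a * of_nat (i k)) (monom_at x0 (i(k := i k - 1)))"
    using m(2) by (simp add: fscale_def partial_const partial_monom_at fun_eq_iff mult.assoc)
qed

lemma Cn_on_scale_monom_at: "Cn_on n U (fscale a (monom_at x0 i))"
proof (induction n arbitrary: a i)
  case 0
  show ?case by (auto simp: fscale_def monom_at_def intro!: continuous_intros)
next
  case (Suc n)
  have "continuous_on U (fscale a (monom_at x0 i))"
    by (auto simp: fscale_def monom_at_def intro!: continuous_intros)
  with Suc show ?case by (simp add: Cn_on_Suc_iff partial_scale_monom_at)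
qed

lemma Cn_on_poly:
  assumes "q \<in> poly_degs x0 A"
  shows "Cn_on n UNIV q"
  using assms
proof (induction rule: poly_degs_induct)
  case zero
  show "Cn_on n UNIV 0" using Cn_on_const[of n UNIV 0] by (simp add: zero_fun_def)
next
  case (add f g)
  then show "Cn_on n UNIV (f + g)" using Cn_on_add[of UNIV n f g] by (simp add: plus_fun_def)
qed (rule Cn_on_scale_monom_at)

lemma partial_poly_degs:
  fixes q :: "real ^ 'd::finite \<Rightarrow> 'k::real_normed_field"
  assumes "q \<in> poly_degs x0 A"
  shows "partial k q \<in> poly_degs x0 {n. Suc n \<in> A}"
  using assms
proof (induction rule: poly_degs_induct)
  case zero
  have "partial k (0 :: real ^ 'd \<Rightarrow> 'k) = 0"
    using partial_const_fun by (simp add: zero_fun_def)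
  then show "partial k (0 :: real ^ 'd \<Rightarrow> 'k) \<in> poly_degs x0 {n. Suc n \<in> A}"
    by (simp only: poly_degs_0)
next
  case (add f g)
  have "partially_differentiable k f x" "partially_differentiable k g x" for x
    using add(1,2)[THEN Cn_on_poly, THEN Cn_on_SucD(1)] by simp_all
  then have "partial k (f + g) = partial k f + partial k g"
    by (simp add: fun_eq_iff plus_fun_def partial_add)
  with add show "partial k (f + g) \<in> poly_degs x0 {n. Suc n \<in> A}"
    by (simp only: poly_degs_add)
next
  case (scale_monom a i)
  show ?case
  proof (cases "i k = 0")
    case True
    then have "partial k (fscale a (monom_at x0 i)) = 0"
      unfolding partial_scale_monom_at by (simp add: fscale_def fun_eq_iff)
    then show ?thesis by (simp only: poly_degs_0)
  next
    case False
    with scale_monom mdeg_decr[of i k] show ?thesis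
      by (auto simp: partial_scale_monom_at intro!: poly_degs_scale monom_in_poly_degs)
  qed
qed

lemma iter_partial_poly_degs:
  assumes "q \<in> poly_degs x0 A"
  shows "iter_partial ks q \<in> poly_degs x0 {n. n + length ks \<in> A}"
  using assms
proof (induction ks arbitrary: q A)
  case Nil
  then show ?case by simp
next
  case (Cons k ks)
  from Cons.IH[OF partial_poly_degs[OF Cons.prems]] show ?case by simp
qed

lemma mpartial_poly_degs:
  fixes q :: "real ^ 'd::finite \<Rightarrow> 'k::real_normed_field"
  assumes "q \<in> poly_degs x0 A"
  shows "mpartial j q \<in> poly_degs x0 {n. n + mdeg j \<in> A}"
proof -
  obtain ks where "length ks = mdeg j" and "\<And>f :: real ^ 'd \<Rightarrow> 'k. mpartial j f = iter_partial ks f"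
    by (rule mpartial_eq_iter_partial[of j]) blast
  with iter_partial_poly_degs[OF assms, of ks] show ?thesis by simp
qed

lemma poly_degs_base:
  assumes "q \<in> poly_degs x0 A" "0 \<notin> A"
  shows "q x0 = 0"
  using assms by (induction rule: poly_degs_induct) (auto simp: fscale_def monom_at_base)

lemma iter_partial_base:
  assumes "q \<in> poly_degs x0 A" "length ks \<notin> A"
  shows "iter_partial ks q x0 = 0"
  using poly_degs_base[OF iter_partial_poly_degs[OF assms(1)]] assms(2) by simp

lemma mpartial_base:
  assumes "q \<in> poly_degs x0 A" "mdeg i \<notin> A"
  shows "mpartial i q x0 = 0"
  using poly_degs_base[OF mpartial_poly_degs[OF assms(1)]] assms(2) by simp


lemma sum_fun_apply: "(\<Sum>l\<in>L. f l) x = (\<Sum>l\<in>L. f l x)"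
  by (induction L rule: infinite_finite_induct) simp_all

lemma mpartial_poly_add:
  fixes f g :: "real ^ 'd::finite \<Rightarrow> 'k::real_normed_field"
  assumes "f \<in> poly_degs x0 A" "g \<in> poly_degs x0 A"
  shows "mpartial j (f + g) = mpartial j f + mpartial j g"
proof
  fix x
  show "mpartial j (f + g) x = (mpartial j f + mpartial j g) x"
    using mpartial_add[of UNIV x j f g] Cn_on_poly[OF assms(1)] Cn_on_poly[OF assms(2)]
    by (simp add: plus_fun_def)
qed

section \<open>Taylor polynomials\<close>

lemma funpow_partial_monom_at:
  "(partial k ^^ n) (fscale b (monom_at x0 i))
    = fscale (b * of_nat (\<Prod>m<n. i k - m)) (monom_at x0 (i(k := i k - n)))"
proof (induction n)
  case (Suc n)
  have "(i(k := i k - n))(k := i k - n - 1) = i(k := i k - Suc n)"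
    by (simp add: fun_eq_iff)
  with Suc show ?case
    by (simp add: partial_scale_monom_at mult.assoc del: fun_upd_apply) simp
qed simp

text \<open>The product uses truncated subtraction on purpose: it contains the factor \<open>0\<close> as soon as some
  coordinate is differentiated more often than its exponent allows.\<close>

lemma mpartial_monom_at:
  fixes b :: "'k::real_normed_field"
  shows "mpartial j (fscale b (monom_at x0 i))
    = fscale (b * of_nat (\<Prod>k\<in>UNIV. \<Prod>m<j k. i k - m)) (monom_at x0 (\<lambda>k. i k - j k))"
proof -
  have "foldr (\<lambda>k. partial k ^^ j k) cs (fscale b (monom_at x0 i))
      = fscale (b * of_nat (\<Prod>k\<in>set cs. \<Prod>m<j k. i k - m))
          (monom_at x0 (\<lambda>k. if k \<in> set cs then i k - j k else i k))"
    if "distinct cs" for cs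
    using that
  proof (induction cs)
    case Nil
    then show ?case by simp
  next
    case (Cons c cs)
    have "(\<lambda>k. if k \<in> set cs then i k - j k else i k)(c := i c - j c)
        = (\<lambda>k. if k \<in> set (c # cs) then i k - j k else i k)"
      by auto
    with Cons show ?case
      by (simp add: funpow_partial_monom_at mult_ac)
  qed
  from this[OF distinct_coords] show ?thesis
    by (simp add: mpartial_def set_coords)
qed

lemma falling_product_self: "(\<Prod>m<n. n - m) = (fact n :: nat)"
  by (simp add: fact_prod_rev atLeast0LessThan)

lemma mpartial_monom_at_base:
  fixes b :: "'k::real_normed_field"
  shows "mpartial j (fscale b (monom_at x0 i)) x0 = (if i = j then b * of_nat (mfact j) else 0)"
proof (cases "mdeg j = mdeg i")
  case False
  then show ?thesis
    using mpartial_base[of "fscale b (monom_at x0 i)" x0 "{mdeg i}" j]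
    by (auto simp: poly_degs_scale monom_in_poly_degs)
next
  case True
  show ?thesis
  proof (cases "i = j")
    case True
    then show ?thesis
      by (simp only: mpartial_monom_at)
        (simp add: fscale_def monom_at_base mdeg_def falling_product_self mfact_def)
  next
    case False
    \<comment> \<open>equal degrees force \<open>i k < j k\<close> somewhere, so the falling product contains a zero factor\<close>
    have "\<exists>k. i k < j k"
    proof (rule ccontr)
      assume "\<nexists>k. i k < j k"
      then have "\<forall>k\<in>UNIV. j k \<le> i k" by (simp add: not_less)
      moreover from this obtain k where "j k < i k"
        using False by (metis UNIV_I ext le_neq_implies_less)
      ultimately have "mdeg j < mdeg i"
        unfolding mdeg_def by (intro sum_strict_mono_ex1) auto
      with \<open>mdeg j = mdeg i\<close> show False by simp
    qed
    then obtain k where "i k < j k" by blast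
    then have "(\<Prod>m<j k. i k - m) = 0" by (intro prod_zero) auto
    then have "(\<Prod>k\<in>UNIV. \<Prod>m<j k. i k - m) = 0" by (intro prod_zero) auto
    with False show ?thesis by (simp only: mpartial_monom_at) (simp add: fscale_def)
  qed
qed

lemma sum_by_mdeg:
  "(\<Sum>l\<in>{0..n}. \<Sum>i\<in>{i. mdeg i = l}. f i) = (\<Sum>i\<in>{i :: 'd::finite mindex. mdeg i \<le> n}. f i)"
proof -
  have "(\<Sum>l\<in>{0..n}. \<Sum>i\<in>{i. mdeg i = l}. f i)
      = (\<Sum>l\<in>{0..n}. \<Sum>i\<in>{i \<in> {i. mdeg i \<le> n}. mdeg i = l}. f i)"
    by (intro sum.cong) auto
  also have "\<dots> = (\<Sum>i\<in>{i. mdeg i \<le> n}. f i)"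
    by (rule sum.group) (auto simp: finite_mdeg_le)
  finally show ?thesis .
qed

lemma taylor_eq_sum:
  "taylor n x0 f
    = (\<Sum>i\<in>{i. mdeg i \<le> n}. fscale (1 / of_nat (mfact i) * mpartial i f x0) (monom_at x0 i))"
  unfolding taylor_def by (rule sum_by_mdeg)

lemma taylor_poly_degs: "taylor n x0 f \<in> poly_degs x0 {..n}"
  unfolding taylor_eq_sum by (intro poly_degs_sum poly_degs_scale monom_in_poly_degs) simp

lemma taylor_add:
  assumes "\<And>i. mdeg i \<le> n \<Longrightarrow> mpartial i h x0 = mpartial i f x0 + mpartial i g x0"
  shows "taylor n x0 h = taylor n x0 f + taylor n x0 g"
  unfolding taylor_eq_sum sum.distrib[symmetric]
  by (intro sum.cong) (auto simp: assms fscale_def fun_eq_iff algebra_simps add_divide_distrib)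

lemma taylor_diff_poly_degs:
  fixes f g :: "real ^ 'd::finite \<Rightarrow> 'k::real_normed_field"
  assumes "\<And>i. mdeg i \<le> n \<Longrightarrow> mdeg i \<notin> A \<Longrightarrow> mpartial i f x0 = mpartial i g x0"
  shows "taylor n x0 f - taylor n x0 g \<in> poly_degs x0 A"
proof -
  have "fscale (1 / of_nat (mfact i) * mpartial i f x0) (monom_at x0 i)
      - fscale (1 / of_nat (mfact i) * mpartial i g x0) (monom_at x0 i) \<in> poly_degs x0 A"
    if "mdeg i \<le> n" for i
  proof (cases "mdeg i \<in> A")
    case True
    then show ?thesis by (intro poly_degs_diff poly_degs_scale monom_in_poly_degs)
  next
    case False
    show ?thesis
      unfolding assms[OF that False] diff_self by (rule poly_degs_0)
  qed
  then show ?thesis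
    unfolding taylor_eq_sum sum_subtractf[symmetric] by (intro poly_degs_sum) blast
qed

lemma taylor_poly:
  fixes q :: "real ^ 'd::finite \<Rightarrow> 'k::real_normed_field"
  assumes "q \<in> poly_degs x0 {..n}"
  shows "taylor n x0 q = q"
  using assms
proof (induction rule: poly_degs_induct)
  case zero
  have "mpartial i (0 :: real ^ 'd \<Rightarrow> 'k) x0 = 0" for i
    using mpartial_base[of 0 x0 "{}" i] poly_degs_0 by auto
  then show "taylor n x0 0 = (0 :: real ^ 'd \<Rightarrow> 'k)"
    unfolding taylor_eq_sum by (simp add: fscale_def fun_eq_iff sum_fun_apply)
next
  case (add f g)
  have "taylor n x0 (f + g) = taylor n x0 f + taylor n x0 g"
    by (rule taylor_add) (simp add: mpartial_poly_add[OF add(1,2)])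
  with add(3,4) show "taylor n x0 (f + g) = f + g" by (simp only:)
next
  case (scale_monom a i)
  have "mfact i \<noteq> 0" by (simp add: mfact_def)
  moreover have "taylor n x0 (fscale a (monom_at x0 i))
      = (\<Sum>j\<in>{j. mdeg j \<le> n}. if j = i then fscale (1 / of_nat (mfact i) * (a * of_nat (mfact i))) (monom_at x0 i) else 0)"
    unfolding taylor_eq_sum
    unfolding mpartial_monom_at_base by (intro sum.cong refl ext) (auto simp: fscale_def)
  ultimately show ?case
    using scale_monom by (simp add: sum.delta finite_mdeg_le)
qed

text \<open>A derivative at the base point sees only the component whose degree is its order, so no Taylor
  coefficient survives, and a polynomial is determined by its Taylor coefficients.\<close>

lemma poly_degs_disjoint:
  assumes "q \<in> poly_degs x0 A" "q \<in> poly_degs x0 B" "A \<inter> B = {}" "A \<subseteq> {..n}"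
  shows "q = 0"
proof -
  have "mpartial i q x0 = 0" for i
    using mpartial_base[OF assms(1), of i] mpartial_base[OF assms(2), of i] assms(3) by blast
  then have "taylor n x0 q = 0"
    unfolding taylor_eq_sum by (simp add: fscale_def fun_eq_iff sum_fun_apply)
  moreover have "taylor n x0 q = q"
    using poly_degs_mono[OF assms(4)] assms(1) by (intro taylor_poly) blast
  ultimately show ?thesis by simp
qed


section \<open>The quasi-Trefftz operator as a perturbation of the frozen operator\<close>

lemma Cn_at_common_neighbourhood:
  assumes "finite J" "\<And>j. j \<in> J \<Longrightarrow> f j \<in> Cn_at n x"
  obtains U where "open U" "x \<in> U" "\<And>j. j \<in> J \<Longrightarrow> Cn_on n U (f j)"
proof -
  have "\<forall>j\<in>J. \<exists>V. open V \<and> x \<in> V \<and> Cn_on n V (f j)"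
    using assms(2) by (auto simp: Cn_at_def)
  then obtain V where V: "\<forall>j\<in>J. open (V j) \<and> x \<in> V j \<and> Cn_on n (V j) (f j)"
    by (rule bchoice[THEN exE])
  show thesis
  proof
    show "open (\<Inter>j\<in>J. V j)" using assms(1) V by (intro open_INT) auto
    show "x \<in> (\<Inter>j\<in>J. V j)" using V by auto
    show "Cn_on n (\<Inter>j\<in>J. V j) (f j)" if "j \<in> J" for j
      using V that by (blast intro: Cn_on_subset)
  qed
qed

lemma diff_op_eq_sum:
  "diff_op \<gamma> c f = (\<lambda>x. \<Sum>j\<in>{j. mdeg j \<le> \<gamma>}. c j x * mpartial j f x)"
  unfolding diff_op_def by (intro ext sum_by_mdeg)

lemma diff_op_poly_add:
  assumes "f \<in> poly_degs x0 A" "g \<in> poly_degs x0 A"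
  shows "diff_op \<gamma> c (f + g) = (\<lambda>x. diff_op \<gamma> c f x + diff_op \<gamma> c g x)"
  by (simp add: diff_op_eq_sum mpartial_poly_add[OF assms] distrib_left sum.distrib)

text \<open>Freezing is itself an instance of variable coefficients, so one computation of leading
  derivatives serves both operators.\<close>

lemma frozen_op_eq_diff_op:
  "frozen_op \<gamma> c x0 = diff_op \<gamma> (\<lambda>j x. if mdeg j = \<gamma> then c j x0 else 0)"
proof (intro ext)
  fix f x
  have "frozen_op \<gamma> c x0 f x = (\<Sum>j\<in>{j. mdeg j \<le> \<gamma>} \<inter> {j. mdeg j = \<gamma>}. c j x0 * mpartial j f x)"
    unfolding frozen_op_def by (intro sum.cong) auto
  also have "\<dots> = (\<Sum>j\<in>{j. mdeg j \<le> \<gamma>}. if j \<in> {j. mdeg j = \<gamma>} then c j x0 * mpartial j f x else 0)"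
    by (rule sum.inter_restrict) (rule finite_mdeg_le)
  also have "\<dots> = diff_op \<gamma> (\<lambda>j x. if mdeg j = \<gamma> then c j x0 else 0) f x"
    unfolding diff_op_eq_sum by (intro sum.cong) auto
  finally show "frozen_op \<gamma> c x0 f x = diff_op \<gamma> (\<lambda>j x. if mdeg j = \<gamma> then c j x0 else 0) f x" .
qed

lemma frozen_op_poly_add:
  assumes "f \<in> poly_degs x0 A" "g \<in> poly_degs x0 A"
  shows "frozen_op \<gamma> c x0 (f + g) = frozen_op \<gamma> c x0 f + frozen_op \<gamma> c x0 g"
  unfolding frozen_op_eq_diff_op diff_op_poly_add[OF assms] by (simp add: plus_fun_def)

lemma frozen_op_poly_degs:
  assumes "q \<in> poly_degs x0 A"
  shows "frozen_op \<gamma> c x0 q \<in> poly_degs x0 {n. n + \<gamma> \<in> A}"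
proof -
  have "frozen_op \<gamma> c x0 q = (\<Sum>j\<in>{j. mdeg j = \<gamma>}. fscale (c j x0) (mpartial j q))"
    by (simp add: fun_eq_iff frozen_op_def fscale_def sum_fun_apply)
  moreover have "\<dots> \<in> poly_degs x0 {n. n + \<gamma> \<in> A}"
    using mpartial_poly_degs[OF assms] by (intro poly_degs_sum poly_degs_scale) auto
  ultimately show ?thesis by (simp only:)
qed

lemma Cn_on_diff_op:
  assumes "open U" "\<And>j. mdeg j \<le> \<gamma> \<Longrightarrow> Cn_on n U (c j)" "q \<in> poly_degs x0 A"
  shows "Cn_on n U (diff_op \<gamma> c q)"
proof -
  have "Cn_on n U (mpartial j q)" for j
    using Cn_on_poly[OF mpartial_poly_degs[OF assms(3)]] by (rule Cn_on_subset) simp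
  then show ?thesis
    unfolding diff_op_eq_sum using assms(2) by (intro Cn_on_sum Cn_on_mult assms(1)) auto
qed

text \<open>A \<open>j\<close>-th derivative of \<open>q\<close> is homogeneous of degree \<open>n - mdeg j\<close>, which is at least the order of
  \<open>i\<close>.  Therefore only the value of the coefficient at \<open>x0\<close> enters, and the terms of order below \<open>\<gamma>\<close>
  drop out because their degree exceeds the order of \<open>i\<close>.  The right-hand side depends on the
  coefficients only through \<open>c j x0\<close> with \<open>mdeg j = \<gamma>\<close>, data that freezing keeps.\<close>

lemma mpartial_diff_op_leading:
  fixes q :: "real ^ 'd::finite \<Rightarrow> 'k::real_normed_field"
  assumes U: "open U" "x0 \<in> U" "\<And>j. mdeg j \<le> \<gamma> \<Longrightarrow> Cn_on (mdeg i) U (c j)"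
    and q: "q \<in> poly_degs x0 {n}" and n: "mdeg i + \<gamma> \<le> n"
  shows "mpartial i (diff_op \<gamma> c q) x0
    = (\<Sum>j\<in>{j. mdeg j \<le> \<gamma>}. if mdeg j = \<gamma> then c j x0 * mpartial i (mpartial j q) x0 else 0)"
proof -
  have C: "Cn_on (mdeg i) U (mpartial j q)" for j
    using Cn_on_poly[OF mpartial_poly_degs[OF q]] by (rule Cn_on_subset) simp
  have "mpartial i (diff_op \<gamma> c q) x0
      = (\<Sum>j\<in>{j. mdeg j \<le> \<gamma>}. mpartial i (\<lambda>x. c j x * mpartial j q x) x0)"
    unfolding diff_op_eq_sum
    using U(3) C by (intro mpartial_sum[OF U(1,2)] Cn_on_mult U(1)) auto
  also have "\<dots> = (\<Sum>j\<in>{j. mdeg j \<le> \<gamma>}. c j x0 * mpartial i (mpartial j q) x0)"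
  proof (intro sum.cong refl)
    fix j :: "'d mindex" assume "j \<in> {j. mdeg j \<le> \<gamma>}"
    with n have j: "mdeg j \<le> \<gamma>" "length ls < mdeg i \<Longrightarrow> length ls + mdeg j \<noteq> n" for ls :: "'d list"
      by auto
    show "mpartial i (\<lambda>x. c j x * mpartial j q x) x0 = c j x0 * mpartial i (mpartial j q) x0"
      using U(3)[OF j(1)] C iter_partial_base[OF mpartial_poly_degs[OF q]] j(2)
      by (intro mpartial_mult_vanishing[OF U(1,2)]) auto
  qed
  also have "\<dots> = (\<Sum>j\<in>{j. mdeg j \<le> \<gamma>}.
      if mdeg j = \<gamma> then c j x0 * mpartial i (mpartial j q) x0 else 0)"
    using n mpartial_base[OF mpartial_poly_degs[OF q], of i] by (intro sum.cong refl) auto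
  finally show ?thesis .
qed

locale trefftz_setting =
  fixes \<gamma> p :: nat
    and x0 :: "real ^ 'd::finite"
    and c :: "'d mindex \<Rightarrow> real ^ 'd \<Rightarrow> 'k::real_normed_field"
  assumes order_less: "\<gamma> < p"
    and coeffs: "\<And>j. mdeg j \<le> \<gamma> \<Longrightarrow> c j \<in> Cn_at (p - \<gamma>) x0"
    and frozen_onto: "frozen_op \<gamma> c x0 ` poly_space p = poly_space (p - \<gamma>)"
begin

abbreviation "D \<equiv> quasi_trefftz_op p \<gamma> c x0"
abbreviation "L \<equiv> frozen_op \<gamma> c x0"
abbreviation "s \<equiv> p - \<gamma>"

lemma coeffs_neighbourhood:
  obtains U where "open U" "x0 \<in> U" "\<And>m j. mdeg j \<le> \<gamma> \<Longrightarrow> m \<le> s \<Longrightarrow> Cn_on m U (c j)"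
  using Cn_at_common_neighbourhood[OF finite_mdeg_le[of \<gamma>], of c s x0] coeffs Cn_on_le
  by (smt (verit, best) mem_Collect_eq)

lemma D_poly_degs: "D q \<in> poly_degs x0 {..s}"
  by (simp add: quasi_trefftz_op_def taylor_poly_degs)

lemma D_add:
  assumes "f \<in> poly_degs x0 A" "g \<in> poly_degs x0 A"
  shows "D (f + g) = D f + D g"
proof -
  obtain U where U: "open U" "x0 \<in> U" "\<And>m j. mdeg j \<le> \<gamma> \<Longrightarrow> m \<le> s \<Longrightarrow> Cn_on m U (c j)"
    using coeffs_neighbourhood by blast
  have "mpartial i (\<lambda>x. diff_op \<gamma> c f x + diff_op \<gamma> c g x) x0
      = mpartial i (diff_op \<gamma> c f) x0 + mpartial i (diff_op \<gamma> c g) x0" if "mdeg i \<le> s" for i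
    using U that assms by (intro mpartial_add[OF U(1,2)] Cn_on_diff_op) auto
  then show ?thesis
    unfolding quasi_trefftz_op_def comp_def diff_op_poly_add[OF assms] by (rule taylor_add)
qed

lemmas L_add = frozen_op_poly_add and L_poly_degs = frozen_op_poly_degs

lemma D_0: "D 0 = 0"
  using D_add[OF poly_degs_0 poly_degs_0] by simp

lemma L_0: "L 0 = 0"
  using L_add[OF poly_degs_0 poly_degs_0, of \<gamma> c x0] by simp

text \<open>The frozen operator maps these polynomials into degree at most \<open>s\<close>, where taking the Taylor
  polynomial changes nothing.  So both summands are Taylor polynomials, and on each monomial their
  coefficients agree in the degrees up to \<open>n\<close>.\<close>

lemma remainder_raises_degree:
  assumes "q \<in> poly_degs x0 {n + \<gamma>..p}"
  shows "D q - L q \<in> poly_degs x0 {Suc n..s}"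
  using assms
proof (induction rule: poly_degs_induct)
  case zero
  have "D 0 - L 0 = 0" by (simp only: D_0 L_0 diff_self)
  then show "D 0 - L 0 \<in> poly_degs x0 {Suc n..s}"
    by (simp only: poly_degs_0)
next
  case (add f g)
  have "D (f + g) - L (f + g) = (D f - L f) + (D g - L g)"
    unfolding D_add[OF add(1,2)] L_add[OF add(1,2)] by (rule add_diff_add)
  with poly_degs_add[OF add(3,4)] show "D (f + g) - L (f + g) \<in> poly_degs x0 {Suc n..s}"
    by (simp only:)
next
  case (scale_monom a k)
  define q where "q = fscale a (monom_at x0 k)"
  have q: "q \<in> poly_degs x0 {mdeg k}"
    unfolding q_def by (intro poly_degs_scale monom_in_poly_degs) simp
  obtain U where U: "open U" "x0 \<in> U" "\<And>m j. mdeg j \<le> \<gamma> \<Longrightarrow> m \<le> s \<Longrightarrow> Cn_on m U (c j)"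
    using coeffs_neighbourhood by blast
  have "{m. m + \<gamma> \<in> {mdeg k}} \<subseteq> {..s}"
    using scale_monom by auto
  with L_poly_degs[OF q] have "L q \<in> poly_degs x0 {..s}"
    using poly_degs_mono by blast
  then have "taylor s x0 (L q) = L q" by (rule taylor_poly)
  moreover have "taylor s x0 (diff_op \<gamma> c q) - taylor s x0 (L q) \<in> poly_degs x0 {Suc n..s}"
  proof (rule taylor_diff_poly_degs)
    fix i :: "'d mindex" assume i: "mdeg i \<le> s" "mdeg i \<notin> {Suc n..s}"
    with scale_monom have n: "mdeg i + \<gamma> \<le> mdeg k" by auto
    let ?c = "\<lambda>j x. if mdeg j = \<gamma> then c j x0 else 0"
    have "Cn_on (mdeg i) U (?c j)" for j
      by (rule Cn_on_const)
    then show "mpartial i (diff_op \<gamma> c q) x0 = mpartial i (L q) x0"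
      unfolding frozen_op_eq_diff_op
      using mpartial_diff_op_leading[OF U(1,2) U(3)[OF _ i(1)] q n]
        mpartial_diff_op_leading[where c = ?c, OF U(1,2) _ q n]
      by (simp cong: if_cong)
  qed
  ultimately have "D q - L q \<in> poly_degs x0 {Suc n..s}"
    by (simp only: quasi_trefftz_op_def comp_def)
  then show "D (fscale a (monom_at x0 k)) - L (fscale a (monom_at x0 k)) \<in> poly_degs x0 {Suc n..s}"
    by (simp only: q_def)
qed

text \<open>Surjectivity is assumed only for the inhomogeneous spaces.  The components of a preimage outside
  degree \<open>n + \<gamma>\<close> are mapped to degrees other than \<open>n\<close>, so their image must vanish and they can be
  discarded.\<close>

lemma frozen_onto_degree:
  assumes "g \<in> poly_degs x0 {n}" "n \<le> s"
  obtains q where "q \<in> poly_degs x0 {n + \<gamma>}" "L q = g"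
proof -
  have "{n} \<subseteq> {..s}" using assms(2) by simp
  with assms(1) have "g \<in> poly_space s"
    unfolding poly_space_eq_poly_degs[of s x0] using poly_degs_mono by blast
  then obtain q where q: "q \<in> poly_degs x0 {..p}" "L q = g"
    using frozen_onto unfolding poly_space_eq_poly_degs[of p x0] by (metis imageE)
  have "{..p} = {n + \<gamma>} \<union> ({..p} - {n + \<gamma>})" using assms(2) order_less by auto
  with q(1) obtain q1 q2 where split: "q1 \<in> poly_degs x0 {n + \<gamma>}"
    "q2 \<in> poly_degs x0 ({..p} - {n + \<gamma>})" "q = q1 + q2"
    using poly_degs_Un by metis
  have "q1 \<in> poly_degs x0 UNIV" "q2 \<in> poly_degs x0 UNIV"
    using split(1,2) poly_degs_mono[OF subset_UNIV] by blast+
  from L_add[OF this] have g: "L q1 + L q2 = g"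
    using q(2) split(3) by simp
  have L1: "L q1 \<in> poly_degs x0 {n}" using L_poly_degs[OF split(1), where \<gamma> = \<gamma> and c = c] by simp
  have "g - L q1 = L q2" using g by (metis add_diff_cancel_left')
  with poly_degs_diff[OF assms(1) L1] have "L q2 \<in> poly_degs x0 {n}"
    by (simp only:)
  then have "L q2 = 0"
    by (rule poly_degs_disjoint[OF _ L_poly_degs[OF split(2)], where n = n]) auto
  with g split(1) that show thesis by (metis add.right_neutral)
qed

text \<open>\<open>k\<close> counts the degrees \<open>n, ..., s\<close> that remain to be matched.\<close>

lemma D_onto_from_degree:
  assumes "n + k = Suc s" "g \<in> poly_degs x0 {n..s}"
  shows "\<exists>q \<in> poly_degs x0 {n + \<gamma>..p}. D q = g"
  using assms
proof (induction k arbitrary: n g)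
  case 0
  then have "g = 0" by (simp add: poly_degs_empty)
  with D_0 poly_degs_0 show ?case by metis
next
  case (Suc k)
  then have n: "n \<le> s" "{n..s} = {n} \<union> {Suc n..s}" by auto
  with Suc.prems obtain g1 g2 where g: "g1 \<in> poly_degs x0 {n}" "g2 \<in> poly_degs x0 {Suc n..s}"
    "g = g1 + g2"
    using poly_degs_Un by metis
  obtain q1 where q1: "q1 \<in> poly_degs x0 {n + \<gamma>}" "L q1 = g1"
    using frozen_onto_degree[OF g(1) n(1)] by blast
  have sub: "{n + \<gamma>} \<subseteq> {n + \<gamma>..p}" "{Suc n + \<gamma>..p} \<subseteq> {n + \<gamma>..p}"
    using n(1) order_less by auto
  have q1': "q1 \<in> poly_degs x0 {n + \<gamma>..p}"
    using q1(1) poly_degs_mono[OF sub(1)] by blast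
  have "g2 - (D q1 - L q1) \<in> poly_degs x0 {Suc n..s}"
    using g(2) remainder_raises_degree[OF q1'] by (rule poly_degs_diff)
  then obtain q2 where q2: "q2 \<in> poly_degs x0 {Suc n + \<gamma>..p}" "D q2 = g2 - (D q1 - L q1)"
    using Suc.IH[of "Suc n"] Suc.prems(1) by auto
  have q2': "q2 \<in> poly_degs x0 {n + \<gamma>..p}"
    using q2(1) poly_degs_mono[OF sub(2)] by blast
  have "D (q1 + q2) = g"
    unfolding D_add[OF q1' q2'] q2(2) q1(2) g(3) by (simp add: algebra_simps)
  with poly_degs_add[OF q1' q2'] show ?case by blast
qed

lemma D_onto: "poly_degs x0 {..s} \<subseteq> D ` poly_degs x0 {\<gamma>..p}"
  using D_onto_from_degree[of 0 "Suc s"] by (force simp: atLeast0AtMost)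

text \<open>On the partial sums of the series, \<open>id - N\<close> telescopes to \<open>g - (N ^^ Suc m) g\<close>, and \<open>N ^^ Suc s\<close>
  sends \<open>g\<close> into the polynomials with degrees in the empty set \<open>{Suc s..s}\<close>.\<close>

lemma neumann_right_inverse:
  assumes lin: "linear_map_on (poly_space s) (poly_space p) S0"
    and inv: "right_inverse_on (poly_space p) (poly_space s) L S0"
    and deg: "\<forall>n\<in>{0..s}. S0 ` hom_space x0 n \<subseteq> hom_space x0 (n + \<gamma>)"
  shows "right_inverse_on (poly_space p) (poly_space s) D
    (S0 \<circ> (\<Sum>l\<in>{0..s}. (- (D - L) \<circ> S0) ^^ l))"
proof -
  define N where "N = - (D - L) \<circ> S0"
  let ?W = "poly_degs x0 {..s} :: (real ^ 'd \<Rightarrow> 'k) set"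
  let ?V = "poly_degs x0 {..p} :: (real ^ 'd \<Rightarrow> 'k) set"
  note W = poly_space_eq_poly_degs[of _ x0]
  have S0_add: "S0 (f + g) = S0 f + S0 g" if "f \<in> ?W" "g \<in> ?W" for f g
    using lin that unfolding linear_map_on_def W by blast
  have S0_V: "S0 f \<in> ?V" if "f \<in> ?W" for f
    using lin that unfolding linear_map_on_def W by blast
  have L_S0: "L (S0 f) = f" if "f \<in> ?W" for f
    using inv that unfolding right_inverse_on_def W by blast
  have S0_0: "S0 0 = 0"
    using S0_add[OF poly_degs_0 poly_degs_0] by simp
  have N_eq: "N f = L (S0 f) - D (S0 f)" for f
    by (simp add: N_def)
  have S0_degs: "S0 f \<in> poly_degs x0 {n + \<gamma>..p}" if "f \<in> poly_degs x0 {n..s}" for n f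
    using that
  proof (induction rule: poly_degs_induct)
    case zero
    show "S0 0 \<in> poly_degs x0 {n + \<gamma>..p}" unfolding S0_0 by (rule poly_degs_0)
  next
    case (add f g)
    have "{n..s} \<subseteq> {..s}" by auto
    with add(1,2) have "f \<in> ?W" "g \<in> ?W" using poly_degs_mono by blast+
    from S0_add[OF this] poly_degs_add[OF add(3,4)]
    show "S0 (f + g) \<in> poly_degs x0 {n + \<gamma>..p}" by (simp only:)
  next
    case (scale_monom a i)
    have "fscale a (monom_at x0 i) \<in> hom_space x0 (mdeg i)"
      unfolding hom_space_eq_poly_degs by (intro poly_degs_scale monom_in_poly_degs) simp
    with deg scale_monom have "S0 (fscale a (monom_at x0 i)) \<in> poly_degs x0 {mdeg i + \<gamma>}"
      unfolding hom_space_eq_poly_degs by (auto simp: image_subset_iff)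
    moreover have "{mdeg i + \<gamma>} \<subseteq> {n + \<gamma>..p}" using scale_monom order_less by auto
    ultimately show ?case using poly_degs_mono by blast
  qed
  have N_degs: "N f \<in> poly_degs x0 {Suc n..s}" if "f \<in> poly_degs x0 {n..s}" for n f
    using poly_degs_neg[OF remainder_raises_degree[OF S0_degs[OF that]]]
    unfolding N_eq minus_diff_eq .
  have N_W: "N f \<in> ?W" if "f \<in> ?W" for f
    using N_degs[of f 0] that poly_degs_mono[of "{1..s}" "{..s}" x0] by (auto simp: atLeast0AtMost)
  have N_add: "N (f + g) = N f + N g" if "f \<in> ?W" "g \<in> ?W" for f g
    unfolding N_eq S0_add[OF that] D_add[OF S0_V[OF that(1)] S0_V[OF that(2)]]
      L_add[OF S0_V[OF that(1)] S0_V[OF that(2)]] by (rule add_diff_add)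
  have N_0: "N 0 = 0" unfolding N_eq S0_0 D_0 L_0 by simp
  have D_S0: "D (S0 u) = u - N u" if "u \<in> ?W" for u
    unfolding N_eq L_S0[OF that] by (simp add: fun_eq_iff)
  show ?thesis
    unfolding right_inverse_on_def W N_def[symmetric]
  proof (intro conjI ballI image_subsetI)
    fix g assume g: "g \<in> ?W"
    have pow: "(N ^^ l) g \<in> poly_degs x0 {l..s}" for l
    proof (induction l)
      case 0
      show ?case using g by (simp add: atLeast0AtMost)
    next
      case (Suc l)
      from N_degs[OF this] show ?case by simp
    qed
    have pow_W: "(N ^^ l) g \<in> ?W" for l
      by (induction l) (simp_all add: g N_W)
    have partial_sum: "(\<Sum>l\<in>{0..m}. (N ^^ l) g) \<in> ?W
        \<and> (\<Sum>l\<in>{0..m}. (N ^^ l) g) - N (\<Sum>l\<in>{0..m}. (N ^^ l) g) = g - (N ^^ Suc m) g" for m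
    proof (induction m)
      case 0
      show ?case using g by simp
    next
      case (Suc m)
      define u where "u = (\<Sum>l\<in>{0..m}. (N ^^ l) g)"
      define v where "v = (N ^^ Suc m) g"
      have v: "v \<in> ?W" unfolding v_def by (rule pow_W)
      have u: "u \<in> ?W" "u - N u = g - v" using Suc by (simp_all only: u_def v_def)
      have sum: "(\<Sum>l\<in>{0..Suc m}. (N ^^ l) g) = u + v"
        by (simp add: u_def v_def)
      have "(u + v) - N (u + v) = (u - N u) + (v - N v)"
        unfolding N_add[OF u(1) v] by (rule add_diff_add)
      also have "\<dots> = g - N v" unfolding u(2) by simp
      also have "N v = (N ^^ Suc (Suc m)) g" by (simp add: v_def)
      finally show ?case unfolding sum using poly_degs_add[OF u(1) v] by blast
    qed
    have "(N ^^ Suc s) g = 0" using pow[of "Suc s"] by (simp add: poly_degs_empty)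
    with partial_sum[of s] D_S0
    have "D (S0 (\<Sum>l\<in>{0..s}. (N ^^ l) g)) = g" by (metis diff_zero)
    then show "D ((S0 \<circ> (\<Sum>l\<in>{0..s}. N ^^ l)) g) = g"
      by (simp add: sum_fun_apply)
    show "(S0 \<circ> (\<Sum>l\<in>{0..s}. N ^^ l)) g \<in> ?V"
      using S0_V partial_sum[of s] by (simp add: sum_fun_apply)
  qed
qed

end

theorem theorem2:
  fixes \<gamma> p :: nat
    and x0 :: "real ^ 'd::finite"
    and c :: "'d mindex \<Rightarrow> real ^ 'd \<Rightarrow> 'k::real_normed_field"
  assumes "\<gamma> \<ge> 1" and "p > \<gamma>"
    and "\<And>j. mdeg j \<le> \<gamma> \<Longrightarrow> c j \<in> Cn_at (p - \<gamma>) x0"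
    and "frozen_op \<gamma> c x0 ` poly_space p = poly_space (p - \<gamma>)"
  shows "quasi_trefftz_op p \<gamma> c x0 ` poly_space p = poly_space (p - \<gamma>)
    \<and> quasi_trefftz_op p \<gamma> c x0 ` hom_sum x0 \<gamma> p = poly_space (p - \<gamma>)
    \<and> (\<forall>S0.
          linear_map_on (poly_space (p - \<gamma>)) (poly_space p) S0
        \<and> right_inverse_on (poly_space p) (poly_space (p - \<gamma>)) (frozen_op \<gamma> c x0) S0
        \<and> (\<forall>n\<in>{0..p - \<gamma>}. S0 ` hom_space x0 n \<subseteq> hom_space x0 (n + \<gamma>))
        \<longrightarrow> (let R = quasi_trefftz_op p \<gamma> c x0 - frozen_op \<gamma> c x0;
                 s = p - \<gamma>;
                 S = S0 \<circ> (\<Sum>l\<in>{0..s}. (- R \<circ> S0) ^^ l)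
             in right_inverse_on (poly_space p) (poly_space (p - \<gamma>)) (quasi_trefftz_op p \<gamma> c x0) S))"
proof -
  interpret trefftz_setting \<gamma> p x0 c
    using assms(2-4) by unfold_locales
  have sub: "poly_degs x0 {\<gamma>..p} \<subseteq> poly_degs x0 {..p}"
    by (rule poly_degs_mono) auto
  have "D ` poly_space p = poly_space s"
    unfolding poly_space_eq_poly_degs[of _ x0] using D_onto sub D_poly_degs by blast
  moreover have "D ` hom_sum x0 \<gamma> p = poly_space s"
    unfolding poly_space_eq_poly_degs[of _ x0] hom_sum_eq_poly_degs
    using D_onto D_poly_degs by blast
  ultimately show ?thesis
    using neumann_right_inverse by (auto simp: Let_def)
qed

end
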